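(* Let $n\ge 1$. (1) Let $\Phi_1,\Phi_2$ be strictly convex Young functions satisfying the local $\Delta_2$-condition. If $F\in L^1(\mathbb{Z}^n\times\mathbb{T}^n)$ and $G\in L^{\Phi_1,\Phi_2}(\mathbb{Z}^n\times\mathbb{T}^n)$, then $$\|F*G\|_{L^{\Phi_1,\Phi_2}(\mathbb{Z}^n\times\mathbb{T}^n)}\le \|F\|_{L^1(\mathbb{Z}^n\times\mathbb{T}^n)}\,\|G\|_{L^{\Phi_1,\Phi_2}(\mathbb{Z}^n\times\mathbb{T}^n)}.$$ (2) Let $\Phi$ be a Young function satisfying the local $\Delta_2$-condition. If $F\in L^1(\mathbb{Z}^n\times\mathbb{T}^n)$ and $G\in L^{\Phi}(\mathbb{Z}^n\times\mathbb{T}^n)$, then $$\|F*G\|_{L^{\Phi}(\mathbb{Z}^n\times\mathbb{T}^n)}\le \|F\|_{L^1(\mathbb{Z}^n\times\mathbb{T}^n)}\,\|G\|_{L^{\Phi}(\mathbb{Z}^n\times\mathbb{T}^n)}.$$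
   Context: A Young function is a convex function $\Phi:[0,\infty]\to[0,\infty]$ with $\Phi(0)=0$ and $\lim_{t\to\infty}\Phi(t)=\Phi(\infty)=\infty$. $\Phi$ satisfies the local $\Delta_2$-condition if there are $r>0$ and $C>0$ with $\Phi(2x)\le C\Phi(x)$ for all $x\in[0,r]$. For a measure space $X$ (here $\mathbb{Z}^n$ with counting measure, $\mathbb{T}^n$ with normalized Haar measure, or $\mathbb{Z}^n\times\mathbb{T}^n$ with the product measure) the Orlicz space $L^\Phi(X)$ (written $\ell^\Phi$ when $X=\mathbb{Z}^n$) consists of the measurable $f:X\to\mathbb{C}$ with $\|f\|_{L^\Phi(X)}=\inf\{b>0:\int_X\Phi(|f|/b)\,d\mu\le 1\}<\infty$. The mixed Orlicz space $L^{\Phi_1,\Phi_2}(\mathbb{Z}^n\times\mathbb{T}^n)$ consists of the measurable $F$ on $\mathbb{Z}^n\times\mathbb{T}^n$ with $\|F\|_{L^{\Phi_1,\Phi_2}(\mathbb{Z}^n\times\mathbb{T}^n)}=\|F_1\|_{L^{\Phi_2}(\mathbb{T}^n)}<\infty$, where $F_1(w)=\|F(\cdot,w)\|_{\ell^{\Phi_1}(\mathbb{Z}^n)}$. Convolution on $\mathbb{Z}^n\times\mathbb{T}^n$: $(F*G)(m,w)=\sum_{l\in\mathbb{Z}^n}\int_{\mathbb{T}^n}F(l,x)\,G(m-l,w-x)\,dx$. *)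

theory Defs
  imports "HOL-Analysis.Analysis"
begin

definition young_function :: "(ennreal \<Rightarrow> ennreal) \<Rightarrow> bool" where
  "young_function \<Phi> \<longleftrightarrow>
     (\<forall>x y. \<forall>u\<in>{0..1::real}.
        \<Phi> (ennreal u * x + ennreal (1 - u) * y) \<le> ennreal u * \<Phi> x + ennreal (1 - u) * \<Phi> y) \<and>
     \<Phi> 0 = 0 \<and>
     ((\<lambda>t::real. \<Phi> (ennreal t)) \<longlongrightarrow> \<infinity>) at_top \<and>
     \<Phi> \<infinity> = \<infinity>"

(* For an extended-valued function strict inequality can only be asked for on the
   effective domain; that domain never contains \<infinity>, since \<Phi> \<infinity> = \<infinity>. *)
definition strictly_convex :: "(ennreal \<Rightarrow> ennreal) \<Rightarrow> bool" where
  "strictly_convex \<Phi> \<longleftrightarrow>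
     (\<forall>x y. \<forall>u\<in>{0<..<1::real}. x \<noteq> y \<longrightarrow> \<Phi> x < \<infinity> \<longrightarrow> \<Phi> y < \<infinity> \<longrightarrow>
        \<Phi> (ennreal u * x + ennreal (1 - u) * y) < ennreal u * \<Phi> x + ennreal (1 - u) * \<Phi> y)"

definition local_Delta2 :: "(ennreal \<Rightarrow> ennreal) \<Rightarrow> bool" where
  "local_Delta2 \<Phi> \<longleftrightarrow>
     (\<exists>r C :: real. r > 0 \<and> C > 0 \<and> (\<forall>x\<in>{0..ennreal r}. \<Phi> (2 * x) \<le> ennreal C * \<Phi> x))"

(* Stated for [0,\<infinity>]-valued functions, because the inner norm in the mixed norm may be \<infinity>
   at some points. The infimum of the empty set is \<infinity>. *)
definition luxemburg_norm :: "(ennreal \<Rightarrow> ennreal) \<Rightarrow> 'a measure \<Rightarrow> ('a \<Rightarrow> ennreal) \<Rightarrow> ennreal" where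
  "luxemburg_norm \<Phi> M f =
     Inf {ennreal b | b :: real. b > 0 \<and> (\<integral>\<^sup>+ x. \<Phi> (f x / ennreal b) \<partial>M) \<le> 1}"

definition orlicz_norm :: "(ennreal \<Rightarrow> ennreal) \<Rightarrow> 'a measure \<Rightarrow> ('a \<Rightarrow> complex) \<Rightarrow> ennreal" where
  "orlicz_norm \<Phi> M f = luxemburg_norm \<Phi> M (\<lambda>x. ennreal (cmod (f x)))"

definition orlicz_space :: "(ennreal \<Rightarrow> ennreal) \<Rightarrow> 'a measure \<Rightarrow> ('a \<Rightarrow> complex) set" where
  "orlicz_space \<Phi> M = {f \<in> borel_measurable M. orlicz_norm \<Phi> M f < \<infinity>}"

definition L1_norm :: "'a measure \<Rightarrow> ('a \<Rightarrow> complex) \<Rightarrow> ennreal" where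
  "L1_norm M f = (\<integral>\<^sup>+ x. ennreal (cmod (f x)) \<partial>M)"

definition L1_space :: "'a measure \<Rightarrow> ('a \<Rightarrow> complex) set" where
  "L1_space M = {f \<in> borel_measurable M. L1_norm M f < \<infinity>}"

(* The torus (\<real>/\<int>)^n is identified with the fundamental domain [0,1)^n; normalized Haar
   measure becomes Lebesgue measure on it, and the group operation is taken modulo 1 in each
   coordinate. *)
definition torus :: "(real ^ 'n) measure" where
  "torus = restrict_space lborel {x. \<forall>i. 0 \<le> x $ i \<and> x $ i < 1}"

definition torus_diff :: "real ^ 'n \<Rightarrow> real ^ 'n \<Rightarrow> real ^ 'n" where
  "torus_diff w x = (\<chi> i. frac (w $ i - x $ i))"

definition ZT :: "((int ^ 'n) \<times> (real ^ 'n)) measure" where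
  "ZT = count_space UNIV \<Otimes>\<^sub>M torus"

definition mixed_orlicz_norm ::
  "(ennreal \<Rightarrow> ennreal) \<Rightarrow> (ennreal \<Rightarrow> ennreal) \<Rightarrow> ((int ^ 'n) \<times> (real ^ 'n) \<Rightarrow> complex) \<Rightarrow> ennreal" where
  "mixed_orlicz_norm \<Phi>1 \<Phi>2 F =
     luxemburg_norm \<Phi>2 torus (\<lambda>w. orlicz_norm \<Phi>1 (count_space UNIV) (\<lambda>m. F (m, w)))"

definition mixed_orlicz_space ::
  "(ennreal \<Rightarrow> ennreal) \<Rightarrow> (ennreal \<Rightarrow> ennreal) \<Rightarrow> ((int ^ 'n) \<times> (real ^ 'n) \<Rightarrow> complex) set" where
  "mixed_orlicz_space \<Phi>1 \<Phi>2 = {F \<in> borel_measurable ZT. mixed_orlicz_norm \<Phi>1 \<Phi>2 F < \<infinity>}"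

definition conv_integrand ::
  "((int ^ 'n) \<times> (real ^ 'n) \<Rightarrow> complex) \<Rightarrow> ((int ^ 'n) \<times> (real ^ 'n) \<Rightarrow> complex) \<Rightarrow>
   (int ^ 'n) \<times> (real ^ 'n) \<Rightarrow> (int ^ 'n) \<times> (real ^ 'n) \<Rightarrow> complex" where
  "conv_integrand F G = (\<lambda>(m, w) (l, x). F (l, x) * G (m - l, torus_diff w x))"

definition conv ::
  "((int ^ 'n) \<times> (real ^ 'n) \<Rightarrow> complex) \<Rightarrow> ((int ^ 'n) \<times> (real ^ 'n) \<Rightarrow> complex) \<Rightarrow>
   (int ^ 'n) \<times> (real ^ 'n) \<Rightarrow> complex" where
  "conv F G z = (\<Sum>\<^sub>\<infinity>l\<in>UNIV. LINT x|torus. conv_integrand F G z (l, x))"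

(* The sum and integrals in conv take the value 0 where they diverge, so convergence has to be
   asserted separately. *)
definition conv_exists ::
  "((int ^ 'n) \<times> (real ^ 'n) \<Rightarrow> complex) \<Rightarrow> ((int ^ 'n) \<times> (real ^ 'n) \<Rightarrow> complex) \<Rightarrow> bool" where
  "conv_exists F G \<longleftrightarrow> (AE z in ZT. integrable ZT (conv_integrand F G z))"

end

theory Submission
  imports Defs
begin

text \<open>Everything follows from Minkowski's integral inequality for Luxemburg norms,
  \<open>\<parallel>\<integral> h y dy\<parallel> \<le> \<integral> \<parallel>h y\<parallel> dy\<close>, and translation invariance. Pointwise, the convolution is bounded by the
  integral of \<open>\<bar>F y\<bar>\<close> times the translate of \<open>\<bar>G\<bar>\<close> by \<open>y\<close>; Minkowski on \<open>\<int>\<^sup>n \<times> \<real>\<^sup>n / \<int>\<^sup>n\<close> gives the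
  second part. For the mixed norm the inequality is applied twice, in \<open>m\<close> for each fixed \<open>w\<close> and then
  in \<open>w\<close>. Finiteness of the bound also gives convergence almost everywhere, because a Young function
  is infinite at infinity.\<close>

section \<open>Young functions: monotonicity, measurability, affine minorants, Jensen's
  inequality\<close>

text \<open>For finite nonzero arguments \<open>x\<close> is the convex combination of
  \<open>y\<close> and 0 with weight \<open>x / y\<close>, and \<open>\<Phi> 0 = 0\<close>; the
  remaining arguments are trivial.\<close>

lemma young_function_mono:
  assumes "young_function \<Phi>"
  shows "mono \<Phi>"
proof
  fix x y :: ennreal assume xy: "x \<le> y"
  from assms have conv: "\<Phi> (ennreal u * a + ennreal (1 - u) * b) \<le> ennreal u * \<Phi> a + ennreal (1 - u) * \<Phi> b"
    if "0 \<le> u" "u \<le> 1" for a b u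
    using that unfolding young_function_def by auto
  have 0: "\<Phi> 0 = 0" and top: "\<Phi> \<infinity> = \<infinity>" using assms unfolding young_function_def by auto
  show "\<Phi> x \<le> \<Phi> y"
  proof (cases "y = \<infinity> \<or> x = 0")
    case True
    then show ?thesis using 0 top by auto
  next
    case False
    then obtain r s where rs: "x = ennreal r" "y = ennreal s" "0 < r" "0 < s"
      using xy by (cases x; cases y) (auto simp: top_unique less_le)
    have le: "r / s \<le> 1" using xy rs by (simp add: ennreal_le_iff)
    have "\<Phi> (ennreal (r / s) * y + ennreal (1 - r / s) * 0)
        \<le> ennreal (r / s) * \<Phi> y + ennreal (1 - r / s) * \<Phi> 0"
      using rs le by (intro conv) auto
    also have "ennreal (r / s) * y + ennreal (1 - r / s) * 0 = x"
      using rs by (simp flip: ennreal_mult'')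
    also have "ennreal (r / s) * \<Phi> y + ennreal (1 - r / s) * \<Phi> 0 \<le> 1 * \<Phi> y"
      using le 0 mult_right_mono[of "ennreal (r / s)" 1 "\<Phi> y"] by (simp add: ennreal_le_1)
    finally show ?thesis by simp
  qed
qed

text \<open>Superlevel sets of a monotone function are closed upwards, and in a complete linear
  order such a set is a closed or open ray starting at its infimum.\<close>

lemma mono_borel_measurable_ennreal:
  fixes f :: "ennreal \<Rightarrow> ennreal"
  assumes "mono f"
  shows "f \<in> borel_measurable borel"
proof (rule borel_measurableI_greater)
  fix c
  define S where "S = {x. c < f x}"
  have up: "y \<in> S" if "x \<in> S" "x \<le> y" for x y
    using that monoD[OF assms, of x y] by (auto simp: S_def)
  have "S = {Inf S..} \<or> S = {Inf S<..}"
  proof (cases "Inf S \<in> S")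
    case True
    then show ?thesis using up by (auto intro: Inf_lower)
  next
    case False
    have "x \<in> S" if "Inf S < x" for x
      using that up by (auto simp: Inf_less_iff)
    moreover have "Inf S < x" if "x \<in> S" for x
      using that False Inf_lower[of x S] by (auto simp: less_le)
    ultimately show ?thesis by auto
  qed
  then have "S \<in> sets borel" by (metis borel_closed borel_open closed_atLeast open_greaterThan)
  then show "{x \<in> space borel. c < f x} \<in> sets borel" by (simp add: S_def)
qed

lemma young_function_measurable:
  "young_function \<Phi> \<Longrightarrow> \<Phi> \<in> borel_measurable borel"
  by (intro mono_borel_measurable_ennreal young_function_mono)

text \<open>A real convex function has a subgradient at every interior point of its domain. The
  intercept \<open>- \<beta>\<close> of the supporting line is moved to the other side, so that no
  subtraction in \<open>ennreal\<close> occurs and the bound is trivial where \<open>\<Phi>\<close>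
  is infinite.\<close>

lemma young_function_supporting_line:
  assumes \<Phi>: "young_function \<Phi>" and s: "0 < s" "s < s1" and fin: "\<Phi> (ennreal s1) < \<infinity>"
  shows "\<exists>\<alpha> \<beta>. 0 \<le> \<alpha> \<and> 0 \<le> \<beta> \<and> (\<forall>t. ennreal \<alpha> * t \<le> \<Phi> t + ennreal \<beta>) \<and>
    \<Phi> (ennreal s) + ennreal \<beta> = ennreal (\<alpha> * s)"
proof -
  define I where "I = {t. 0 \<le> t \<and> \<Phi> (ennreal t) < \<infinity>}"
  define \<phi> where "\<phi> t = enn2real (\<Phi> (ennreal t))" for t
  have mono: "\<Phi> x \<le> \<Phi> y" if "x \<le> y" for x y
    using young_function_mono[OF \<Phi>] that by (rule monoD)
  have 0: "\<Phi> 0 = 0" and top: "\<Phi> \<infinity> = \<infinity>" using \<Phi> unfolding young_function_def by auto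
  have \<phi>: "\<Phi> (ennreal t) = ennreal (\<phi> t)" if "t \<in> I" for t
    using that by (simp add: \<phi>_def I_def)
  have \<phi>0: "\<phi> 0 = 0" by (simp add: \<phi>_def 0)
  have \<phi>_ge0: "0 \<le> \<phi> t" for t by (simp add: \<phi>_def)
  have II: "t \<in> I" if "0 \<le> t" "t \<le> u" "u \<in> I" for t u
    using that mono[of "ennreal t" "ennreal u"] by (auto simp: I_def ennreal_leI)
  have "convex_on I \<phi>"
  proof
    fix t x y :: real assume t: "0 < t" "t < 1" and xy: "x \<in> I" "y \<in> I"
    have nn: "0 \<le> x" "0 \<le> y" using xy by (auto simp: I_def)
    define z where "z = (1 - t) *\<^sub>R x + t *\<^sub>R y"
    have z: "ennreal z = ennreal t * ennreal y + ennreal (1 - t) * ennreal x"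
      using t nn by (simp add: z_def add.commute flip: ennreal_mult ennreal_plus)
    have "\<Phi> (ennreal z) \<le> ennreal t * \<Phi> (ennreal y) + ennreal (1 - t) * \<Phi> (ennreal x)"
      unfolding z using \<Phi> t unfolding young_function_def by auto
    also have "\<dots> = ennreal ((1 - t) * \<phi> x + t * \<phi> y)"
      using t \<phi>_ge0 by (simp add: \<phi> xy add.commute flip: ennreal_mult ennreal_plus)
    finally have le: "\<Phi> (ennreal z) \<le> ennreal ((1 - t) * \<phi> x + t * \<phi> y)" .
    then have "\<Phi> (ennreal z) < \<infinity>" by (rule le_less_trans) simp
    with le show "\<phi> z \<le> (1 - t) * \<phi> x + t * \<phi> y"
      unfolding \<phi>_def[of z] using t \<phi>_ge0 by (intro enn2real_leI) auto
  next
    show "convex I"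
      unfolding convex_alt
    proof (intro ballI allI impI)
      fix x y u :: real assume *: "x \<in> I" "y \<in> I" "0 \<le> u \<and> u \<le> 1"
      then have nn: "0 \<le> x" "0 \<le> y" by (auto simp: I_def)
      have "(1 - u) * x + u * y \<le> max x y"
        by (rule convex_bound_le) (use * in auto)
      moreover have "max x y \<in> I" using *(1,2) by (simp add: max_def)
      moreover have "0 \<le> (1 - u) * x + u * y" using * nn by (intro add_nonneg_nonneg mult_nonneg_nonneg) auto
      ultimately have "(1 - u) * x + u * y \<in> I" by (rule II[rotated])
      then show "(1 - u) *\<^sub>R x + u *\<^sub>R y \<in> I" by simp
    qed
  qed
  moreover have sI: "{0..s1} \<subseteq> I" using II fin s by (auto simp: I_def)
  \<comment> \<open>Finiteness at \<open>s1\<close>, strictly to the right, keeps \<open>s\<close>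
    away from the right end of the effective domain; \<open>0 < s\<close> keeps it away from the
    left end.\<close>
  have "s \<in> interior I"
    by (rule interiorI[of "{0<..<s1}"]) (use sI s in auto)
  ultimately obtain k where k: "\<And>t. t \<in> I \<Longrightarrow> \<phi> s + k * (t - s) \<le> \<phi> t"
    using that[OF convex_le_Inf_differential] by metis
  have s_in: "s \<in> I" "s1 \<in> I" "0 \<in> I" using sI s by auto
  \<comment> \<open>At 0 the supporting line lies below \<open>\<phi> 0 = 0\<close>. Its negated
    value there, \<open>k * s - \<phi> s\<close>, is the nonnegative witness for
    \<open>\<beta>\<close> below.\<close>
  have ks: "\<phi> s \<le> k * s" using k[OF s_in(3)] \<phi>0 by simp
  have "0 \<le> k * s" using ks \<phi>_ge0[of s] by linarith
  then have k0: "0 \<le> k" using s by (simp add: zero_le_mult_iff)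
  show ?thesis
  proof (rule exI[of _ k], rule exI[of _ "k * s - \<phi> s"], intro conjI allI)
    fix t
    show "ennreal k * t \<le> \<Phi> t + ennreal (k * s - \<phi> s)"
    proof (cases "\<Phi> t = \<infinity>")
      case False
      then obtain r where r: "t = ennreal r" "0 \<le> r" using top by (cases t) auto
      with False have "r \<in> I" by (simp add: I_def less_top)
      then have "k * r \<le> \<phi> r + (k * s - \<phi> s)" using k[of r] by (simp add: algebra_simps)
      then show ?thesis using \<phi>[OF \<open>r \<in> I\<close>] r k0 ks \<phi>_ge0[of r]
        by (simp add: ennreal_leI flip: ennreal_mult ennreal_plus)
    qed simp
  next
    show "\<Phi> (ennreal s) + ennreal (k * s - \<phi> s) = ennreal (k * s)"
      using \<phi>[OF s_in(1)] ks \<phi>_ge0[of s] by (simp flip: ennreal_plus)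
  qed (use k0 ks in auto)
qed

text \<open>The gap between \<open>s\<close> and \<open>m\<close> is what makes this true without lower semicontinuity: a Young
  function may jump at the right end of its effective domain.\<close>

lemma young_function_affine_minorant:
  assumes \<Phi>: "young_function \<Phi>" and s: "s < m" and c: "ennreal c < \<Phi> s" "0 \<le> c"
  shows "\<exists>\<alpha> \<beta>. \<beta> < \<infinity> \<and> (\<forall>t. \<alpha> * t \<le> \<Phi> t + \<beta>) \<and> ennreal c + \<beta> \<le> \<alpha> * m"
proof -
  have mono: "\<Phi> x \<le> \<Phi> y" if "x \<le> y" for x y
    using young_function_mono[OF \<Phi>] that by (rule monoD)
  have 0: "\<Phi> 0 = 0" using \<Phi> unfolding young_function_def by auto
  obtain s' where s': "s = ennreal s'" "0 \<le> s'" using s by (cases s) auto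
  have "s' \<noteq> 0" using c s' 0 by auto
  then have s'0: "0 < s'" using s' by simp
  \<comment> \<open>If \<open>\<Phi>\<close> is finite at this point of the gap, then
    \<open>s\<close> is interior to the effective domain and a supporting line at \<open>s\<close>
    works; otherwise \<open>\<Phi>\<close> is infinite from \<open>m1\<close> on.\<close>
  obtain m1 where m1: "s < m1" "m1 < m" using s dense by blast
  then obtain r where r: "m1 = ennreal r" "0 \<le> r" by (cases m1) auto
  then have sr: "s' < r" using m1 s' by (simp add: ennreal_less_iff)
  show ?thesis
  proof (cases "\<Phi> m1 < \<infinity>")
    case True
    then obtain \<alpha> \<beta> where *: "0 \<le> \<alpha>" "0 \<le> \<beta>" "\<And>t. ennreal \<alpha> * t \<le> \<Phi> t + ennreal \<beta>"
        "\<Phi> s + ennreal \<beta> = ennreal (\<alpha> * s')"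
      using young_function_supporting_line[OF \<Phi> s'0 sr] unfolding r s' by auto
    have "ennreal c + ennreal \<beta> \<le> \<Phi> s + ennreal \<beta>" using c by (intro add_mono) auto
    also have "\<dots> = ennreal \<alpha> * s" using * s' by (simp add: ennreal_mult)
    also have "\<dots> \<le> ennreal \<alpha> * m" using s by (intro mult_left_mono) auto
    finally show ?thesis using *
      by - (rule exI[of _ "ennreal \<alpha>"], rule exI[of _ "ennreal \<beta>"], auto)
  next
    case False
    obtain m2 where m2: "m1 < m2" "m2 < m" using m1 dense by blast
    then obtain q where q: "m2 = ennreal q" "0 \<le> q" by (cases m2) auto
    then have rq: "r < q" using m2 r by (simp add: ennreal_less_iff)
    \<comment> \<open>The line is 0 at \<open>r\<close> and \<open>c\<close> at \<open>q\<close>. To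
      the left of \<open>r\<close> it is at most 0, from \<open>r\<close> on \<open>\<Phi>\<close>
      is infinite, and at \<open>m\<close>, beyond \<open>q\<close>, it is at least
      \<open>c\<close>.\<close>
    define \<alpha> where "\<alpha> = c / (q - r)"
    have \<alpha>: "0 \<le> \<alpha>" using c rq by (simp add: \<alpha>_def)
    have "ennreal \<alpha> * t \<le> \<Phi> t + ennreal (\<alpha> * r)" for t
    proof (cases "t < m1")
      case True
      then have "ennreal \<alpha> * t \<le> ennreal \<alpha> * ennreal r"
        using r by (intro mult_left_mono) auto
      then show ?thesis using \<alpha> r by (auto simp: ennreal_mult intro: add_increasing)
    next
      case False
      with \<open>\<not> \<Phi> m1 < \<infinity>\<close> mono[of m1 t] have "\<Phi> t = \<infinity>" by (metis infinity_ennreal_def not_le top.not_eq_extremum top_unique)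
      then show ?thesis by simp
    qed
    moreover have "ennreal c + ennreal (\<alpha> * r) \<le> ennreal \<alpha> * m"
    proof -
      have "c + \<alpha> * r = \<alpha> * q" using rq by (simp add: \<alpha>_def field_simps)
      then have "ennreal c + ennreal (\<alpha> * r) = ennreal \<alpha> * m2"
        using q c \<alpha> r by (simp flip: ennreal_plus ennreal_mult)
      also have "\<dots> \<le> ennreal \<alpha> * m" using m2 by (intro mult_left_mono) auto
      finally show ?thesis .
    qed
    ultimately show ?thesis
      by - (rule exI[of _ "ennreal \<alpha>"], rule exI[of _ "ennreal (\<alpha> * r)"], auto)
  qed
qed

text \<open>Integrate an affine minorant \<open>\<alpha> * t - \<beta>\<close> of
  \<open>\<Phi>\<close> against \<open>p\<close>. Mass below 1 does no harm, since the intercept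
  \<open>- \<beta>\<close> is at most 0. Strictness in the hypothesis on \<open>s\<close> supplies
  the gap that the minorant requires.\<close>

lemma young_function_jensen:
  assumes \<Phi>: "young_function \<Phi>"
    and [measurable]: "p \<in> borel_measurable N" "g \<in> borel_measurable N"
    and p: "(\<integral>\<^sup>+y. p y \<partial>N) \<le> 1" and s: "s < (\<integral>\<^sup>+y. p y * g y \<partial>N)"
  shows "\<Phi> s \<le> (\<integral>\<^sup>+y. p y * \<Phi> (g y) \<partial>N)"
proof (rule ccontr)
  note [measurable] = young_function_measurable[OF \<Phi>]
  let ?J = "\<integral>\<^sup>+y. p y * \<Phi> (g y) \<partial>N"
  assume "\<not> \<Phi> s \<le> ?J"
  \<comment> \<open>A value strictly between the two sides: being below \<open>\<Phi> s\<close>, it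
    is reached by some affine minorant at the mean.\<close>
  then obtain c' where c': "?J < c'" "c' < \<Phi> s" by (meson dense not_le)
  then obtain c where c: "c' = ennreal c" "0 \<le> c" by (cases c') auto
  obtain \<alpha> \<beta> where *: "\<beta> < \<infinity>" "\<And>t. \<alpha> * t \<le> \<Phi> t + \<beta>" "ennreal c + \<beta> \<le> \<alpha> * (\<integral>\<^sup>+y. p y * g y \<partial>N)"
    using young_function_affine_minorant[OF \<Phi> s, of c] c c' by auto
  have "ennreal c + \<beta> \<le> (\<integral>\<^sup>+y. p y * (\<alpha> * g y) \<partial>N)"
    using *(3) by (simp add: nn_integral_cmult[symmetric] mult.left_commute)
  also have "\<dots> \<le> (\<integral>\<^sup>+y. p y * (\<Phi> (g y) + \<beta>) \<partial>N)"
    using *(2) by (intro nn_integral_mono mult_left_mono) auto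
  also have "\<dots> = ?J + \<beta> * (\<integral>\<^sup>+y. p y \<partial>N)"
    by (simp add: distrib_left nn_integral_add nn_integral_cmult mult.commute[of _ \<beta>])
  also have "\<dots> \<le> ?J + \<beta> * 1"
    using p by (intro add_left_mono mult_left_mono) auto
  finally have "ennreal c \<le> ?J" using *(1) by (auto simp: ennreal_add_left_cancel_le add.commute)
  with c' c show False by auto
qed

section \<open>Luxemburg norms: order, scaling, finiteness\<close>

lemma luxemburg_norm_le:
  "0 < b \<Longrightarrow> (\<integral>\<^sup>+x. \<Phi> (f x / ennreal b) \<partial>M) \<le> 1 \<Longrightarrow> luxemburg_norm \<Phi> M f \<le> ennreal b"
  unfolding luxemburg_norm_def by (intro Inf_lower) auto

lemma luxemburg_norm_less_iff:
  "luxemburg_norm \<Phi> M f < c \<longleftrightarrow>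
    (\<exists>b>0. ennreal b < c \<and> (\<integral>\<^sup>+x. \<Phi> (f x / ennreal b) \<partial>M) \<le> 1)"
  unfolding luxemburg_norm_def by (auto simp: Inf_less_iff)

lemma divide_mono_ennreal:
  fixes a b x y :: ennreal
  assumes "x \<le> y" "a \<le> b"
  shows "x / b \<le> y / a"
proof -
  have "x / b \<le> x / a"
  proof (cases "a = 0 \<or> b = \<infinity>")
    case True
    then show ?thesis by (cases "x = 0") (auto simp: ennreal_divide_zero)
  next
    case False
    then obtain a' b' where "a = ennreal a'" "b = ennreal b'" "0 < a'" "0 < b'" "a' \<le> b'"
      using assms(2) by (cases a; cases b) (auto simp: less_le ennreal_le_iff top_unique)
    then show ?thesis
      by (cases x) (auto simp: divide_ennreal ennreal_top_divide intro!: ennreal_leI divide_left_mono)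
  qed
  also have "\<dots> \<le> y / a" using assms(1) by (rule divide_right_mono_ennreal)
  finally show ?thesis .
qed

lemma young_function_nn_integral_divide_mono:
  assumes \<Phi>: "young_function \<Phi>" and "a \<le> b" "\<And>x. x \<in> space M \<Longrightarrow> f x \<le> g x"
  shows "(\<integral>\<^sup>+x. \<Phi> (f x / b) \<partial>M) \<le> (\<integral>\<^sup>+x. \<Phi> (g x / a) \<partial>M)"
  using assms
  by (intro nn_integral_mono monoD[OF young_function_mono[OF \<Phi>]])
     (auto intro: divide_mono_ennreal)

lemma luxemburg_norm_mono:
  assumes \<Phi>: "young_function \<Phi>" and fg: "\<And>x. x \<in> space M \<Longrightarrow> f x \<le> g x"
  shows "luxemburg_norm \<Phi> M f \<le> luxemburg_norm \<Phi> M g"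
  unfolding luxemburg_norm_def[of _ _ g]
  by (safe intro!: Inf_greatest luxemburg_norm_le)
    (rule order_trans[OF young_function_nn_integral_divide_mono[OF \<Phi> order_refl fg]])

text \<open>The infimum need not be attained, as \<open>\<Phi>\<close> may jump. Strictly above it
  there is a smaller admissible scale, and the integral decreases as the scale grows.\<close>

lemma nn_integral_le_1_of_luxemburg_norm_less:
  assumes \<Phi>: "young_function \<Phi>" and "luxemburg_norm \<Phi> M f < b"
  shows "(\<integral>\<^sup>+x. \<Phi> (f x / b) \<partial>M) \<le> 1"
proof -
  obtain a where a: "ennreal a < b" "(\<integral>\<^sup>+x. \<Phi> (f x / ennreal a) \<partial>M) \<le> 1"
    using assms by (auto simp: luxemburg_norm_less_iff)
  have "(\<integral>\<^sup>+x. \<Phi> (f x / b) \<partial>M) \<le> (\<integral>\<^sup>+x. \<Phi> (f x / ennreal a) \<partial>M)"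
    using a(1) by (intro young_function_nn_integral_divide_mono[OF \<Phi>]) auto
  also note a(2)
  finally show ?thesis .
qed

lemma luxemburg_norm_zero:
  assumes \<Phi>: "young_function \<Phi>"
  shows "luxemburg_norm \<Phi> M (\<lambda>x. 0) = 0"
proof -
  have 0: "\<Phi> 0 = 0" using \<Phi> unfolding young_function_def by auto
  have "luxemburg_norm \<Phi> M (\<lambda>x. 0) \<le> 0 + ennreal e" if "0 < e" for e
    using that luxemburg_norm_le[of e M \<Phi> "\<lambda>x. 0"] by (simp add: 0)
  then have "luxemburg_norm \<Phi> M (\<lambda>x. 0) \<le> 0" by (rule ennreal_le_epsilon)
  then show ?thesis by simp
qed

lemma luxemburg_norm_cmult_le:
  assumes \<Phi>: "young_function \<Phi>" and a: "0 \<le> a"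
  shows "luxemburg_norm \<Phi> M (\<lambda>x. ennreal a * f x) \<le> ennreal a * luxemburg_norm \<Phi> M f"
\<comment> \<open>As \<open>0 * \<infinity> = 0\<close>, the right side is 0 here even if
  \<open>f\<close> has infinite norm, so the norm of the zero function has to vanish.\<close>
proof (cases "a = 0")
  case True
  then show ?thesis by (simp add: luxemburg_norm_zero[OF \<Phi>])
next
  case False
  then have a: "0 < a" using a by simp
  have *: "luxemburg_norm \<Phi> M (\<lambda>x. ennreal a * f x) / ennreal a \<le> luxemburg_norm \<Phi> M f"
    unfolding luxemburg_norm_def[of _ _ f]
  proof (safe intro!: Inf_greatest)
    fix b :: real assume b: "0 < b" "(\<integral>\<^sup>+x. \<Phi> (f x / ennreal b) \<partial>M) \<le> 1"
    have "ennreal a * f x / ennreal (a * b) = f x / ennreal b" for x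
      using divide_mult_eq[of "ennreal a" "f x" "ennreal b"] a b
      by (simp add: ennreal_mult mult.commute)
    then have "luxemburg_norm \<Phi> M (\<lambda>x. ennreal a * f x) \<le> ennreal (a * b)"
      using a b by (intro luxemburg_norm_le) auto
    then show "luxemburg_norm \<Phi> M (\<lambda>x. ennreal a * f x) / ennreal a \<le> ennreal b"
      using a b by (intro divide_le_posI_ennreal) (auto simp: ennreal_mult)
  qed
  have "luxemburg_norm \<Phi> M (\<lambda>x. ennreal a * f x)
      = ennreal a * (luxemburg_norm \<Phi> M (\<lambda>x. ennreal a * f x) / ennreal a)"
    using a mult_divide_eq_ennreal[of "ennreal a" "luxemburg_norm \<Phi> M (\<lambda>x. ennreal a * f x)"]
    by (simp add: ennreal_times_divide mult.commute[of "ennreal a" "luxemburg_norm _ _ _"])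
  also have "\<dots> \<le> ennreal a * luxemburg_norm \<Phi> M f"
    using * by (rule mult_left_mono) simp
  finally show ?thesis .
qed

text \<open>A finite norm yields a finite scale \<open>b\<close> at which
  \<open>\<Phi> (f x / b)\<close> has a finite integral; since
  \<open>\<Phi> \<infinity> = \<infinity>\<close>, this integrand is infinite wherever
  \<open>f\<close> is.\<close>

lemma AE_finite_of_luxemburg_norm_finite:
  assumes \<Phi>: "young_function \<Phi>" and [measurable]: "f \<in> borel_measurable M"
    and fin: "luxemburg_norm \<Phi> M f < \<infinity>"
  shows "AE x in M. f x < \<infinity>"
proof -
  note [measurable] = young_function_measurable[OF \<Phi>]
  have top: "\<Phi> \<infinity> = \<infinity>" using \<Phi> unfolding young_function_def by auto
  obtain b where b: "0 < b" "(\<integral>\<^sup>+x. \<Phi> (f x / ennreal b) \<partial>M) \<le> 1"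
    using fin by (auto simp: luxemburg_norm_less_iff)
  have "AE x in M. \<Phi> (f x / ennreal b) \<noteq> \<infinity>"
    using b by (intro nn_integral_noteq_infinite) (auto simp: top_unique)
  then show ?thesis
  proof eventually_elim
    case (elim x)
    have "f x \<noteq> \<infinity>" using elim top by (auto simp: ennreal_top_divide)
    then show ?case by (simp add: less_top)
  qed
qed

section \<open>Minkowski's integral inequality for Luxemburg norms\<close>

text \<open>The infimum runs over uncountably many scales, but by monotonicity of
  \<open>\<Phi>\<close> rational ones suffice to test whether it is below \<open>c\<close>. Each
  sublevel set is then a countable union of sets defined by parametric integrals.\<close>

lemma borel_measurable_luxemburg_norm:
  assumes \<Phi>: "young_function \<Phi>" and "sigma_finite_measure M"
    and h[measurable]: "(\<lambda>(y, x). h y x) \<in> borel_measurable (N \<Otimes>\<^sub>M M)"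
  shows "(\<lambda>y. luxemburg_norm \<Phi> M (h y)) \<in> borel_measurable N"
proof (rule borel_measurableI_less)
  interpret sigma_finite_measure M by fact
  note [measurable] = young_function_measurable[OF \<Phi>]
  fix c
  have "luxemburg_norm \<Phi> M (h y) < c \<longleftrightarrow>
      (\<exists>q\<in>{q\<in>\<rat>. 0 < q \<and> ennreal q < c}. (\<integral>\<^sup>+x. \<Phi> (h y x / ennreal q) \<partial>M) \<le> 1)" for y
  proof
    assume "luxemburg_norm \<Phi> M (h y) < c"
    then obtain b where b: "0 < b" "ennreal b < c" "(\<integral>\<^sup>+x. \<Phi> (h y x / ennreal b) \<partial>M) \<le> 1"
      by (auto simp: luxemburg_norm_less_iff)
    \<comment> \<open>Room for a rational scale strictly between \<open>b\<close> and
      \<open>c\<close>; enlarging the scale keeps it admissible.\<close>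
    obtain d where d: "ennreal b < d" "d < c" using b dense by blast
    then obtain d' where d': "d = ennreal d'" "0 \<le> d'" by (cases d) auto
    then have "b < d'" using b d by (simp add: ennreal_less_iff)
    then obtain q where q: "q \<in> \<rat>" "b < q" "q < d'" using Rats_dense_in_real by blast
    then have "ennreal q \<le> d" using d' by (simp add: ennreal_leI)
    then have "ennreal q < c" using d(2) by (rule le_less_trans)
    moreover have "(\<integral>\<^sup>+x. \<Phi> (h y x / ennreal q) \<partial>M) \<le> (\<integral>\<^sup>+x. \<Phi> (h y x / ennreal b) \<partial>M)"
      using q by (intro young_function_nn_integral_divide_mono[OF \<Phi>]) (auto intro: ennreal_leI)
    ultimately show "\<exists>q\<in>{q\<in>\<rat>. 0 < q \<and> ennreal q < c}. (\<integral>\<^sup>+x. \<Phi> (h y x / ennreal q) \<partial>M) \<le> 1"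
      using q b by (intro bexI[of _ q]) auto
  qed (auto simp: luxemburg_norm_less_iff)
  then have "{y \<in> space N. luxemburg_norm \<Phi> M (h y) < c} =
      (\<Union>q\<in>{q\<in>\<rat>. 0 < q \<and> ennreal q < c}. {y \<in> space N. (\<integral>\<^sup>+x. \<Phi> (h y x / ennreal q) \<partial>M) \<le> 1})"
    by auto
  also have "\<dots> \<in> sets N"
  proof (rule sets.countable_UN')
    show "countable {q \<in> \<rat>. 0 < q \<and> ennreal q < c}"
      by (rule countable_subset[OF _ countable_rat]) auto
  next
    show "(\<lambda>q. {y \<in> space N. (\<integral>\<^sup>+x. \<Phi> (h y x / ennreal q) \<partial>M) \<le> 1}) `
        {q \<in> \<rat>. 0 < q \<and> ennreal q < c} \<subseteq> sets N"
      by (intro image_subsetI) measurable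
  qed
  finally show "{y \<in> space N. luxemburg_norm \<Phi> M (h y) < c} \<in> sets N" .
qed

text \<open>Up to the perturbation \<open>\<epsilon> \<eta>\<close>, which makes the weights positive
  and strictly larger than the norms, it is Jensen's inequality for the weights
  \<open>luxemburg_norm \<Phi> M (h y) / b\<close>.\<close>

lemma luxemburg_norm_nn_integral_le:
  assumes \<Phi>: "young_function \<Phi>" and M: "sigma_finite_measure M" and N: "sigma_finite_measure N"
    and h[measurable]: "(\<lambda>(y, x). h y x) \<in> borel_measurable (N \<Otimes>\<^sub>M M)"
  shows "luxemburg_norm \<Phi> M (\<lambda>x. \<integral>\<^sup>+y. h y x \<partial>N) \<le> (\<integral>\<^sup>+y. luxemburg_norm \<Phi> M (h y) \<partial>N)"
\<comment> \<open>It suffices to reach every bound strictly above the integral of the norms, which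
  leaves some slack.\<close>
proof (rule dense_ge)
  interpret M: sigma_finite_measure M by fact
  interpret N: sigma_finite_measure N by fact
  interpret pair_sigma_finite N M ..
  note [measurable] = young_function_measurable[OF \<Phi>]
  let ?n = "\<lambda>y. luxemburg_norm \<Phi> M (h y)"
  have [measurable]: "?n \<in> borel_measurable N"
    by (rule borel_measurable_luxemburg_norm[OF \<Phi> M h])
  fix b' assume S: "(\<integral>\<^sup>+y. ?n y \<partial>N) < b'"
  show "luxemburg_norm \<Phi> M (\<lambda>x. \<integral>\<^sup>+y. h y x \<partial>N) \<le> b'"
  proof (cases b')
    case (real b)
    \<comment> \<open>The slack is split at \<open>a\<close>: up to \<open>a\<close> it pays for
      weights larger than the norms, and \<open>a < b\<close> is kept for the strict inequality in
      Jensen.\<close>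
    then obtain a where a: "(\<integral>\<^sup>+y. ?n y \<partial>N) < ennreal a" "a < b" "0 < a"
    proof -
      obtain a' where a': "(\<integral>\<^sup>+y. ?n y \<partial>N) < a'" "a' < ennreal b" using S real dense by blast
      then obtain a where a: "a' = ennreal a" "0 \<le> a" by (cases a') auto
      then have "a \<noteq> 0" using a' by auto
      with that[of a] a a' show thesis by (simp add: ennreal_less_iff)
    qed
    \<comment> \<open>Sigma-finiteness gives an everywhere positive function with finite integral,
      even if \<open>N\<close> has infinite mass.\<close>
    obtain \<eta> where \<eta>[measurable]: "\<eta> \<in> borel_measurable N" and
      \<eta>_fin: "integral\<^sup>N N \<eta> \<noteq> \<infinity>" and \<eta>_pos: "\<And>y. y \<in> space N \<Longrightarrow> 0 < \<eta> y \<and> \<eta> y < \<infinity>"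
      using N.Ex_finite_integrable_function by auto
    obtain \<epsilon> where \<epsilon>: "0 < \<epsilon>" "(\<integral>\<^sup>+y. ?n y \<partial>N) + ennreal \<epsilon> * integral\<^sup>N N \<eta> \<le> ennreal a"
    proof -
      obtain S' I' where *: "(\<integral>\<^sup>+y. ?n y \<partial>N) = ennreal S'" "0 \<le> S'"
          "integral\<^sup>N N \<eta> = ennreal I'" "0 \<le> I'"
        using a \<eta>_fin by (cases "\<integral>\<^sup>+y. ?n y \<partial>N"; cases "integral\<^sup>N N \<eta>") auto
      have lt: "S' < a" using a * by (simp add: ennreal_less_iff)
      have "(a - S') * I' \<le> (a - S') * (I' + 1)" using lt by (intro mult_left_mono) auto
      \<comment> \<open>The witness for \<open>\<epsilon>\<close> is
        \<open>(a - S') / (I' + 1)\<close>; the added 1 keeps the denominator positive when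
        \<open>I' = 0\<close>.\<close>
      then have "S' + (a - S') / (I' + 1) * I' \<le> a" using * by (simp add: field_simps)
      moreover have "0 < (a - S') / (I' + 1)" using lt * by simp
      ultimately obtain \<epsilon> where \<epsilon>: "0 < \<epsilon>" "S' + \<epsilon> * I' \<le> a" using that by blast
      then have "ennreal S' + ennreal \<epsilon> * ennreal I' \<le> ennreal a"
        using * by (simp add: ennreal_leI flip: ennreal_mult ennreal_plus)
      with \<epsilon> show thesis using that * by simp
    qed
    \<comment> \<open>Wherever \<open>w y\<close> is finite it strictly exceeds the norm of
      \<open>h y\<close>, so it is an admissible scale for \<open>h y\<close>. Dividing by
      \<open>a\<close> turns these scales into weights of total mass at most 1.\<close>
    define w where "w y = ?n y + ennreal \<epsilon> * \<eta> y" for y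
    define p where "p y = w y / ennreal a" for y
    have [measurable]: "w \<in> borel_measurable N" "p \<in> borel_measurable N"
      unfolding w_def[abs_def] p_def[abs_def] by measurable
    have "(\<integral>\<^sup>+y. w y \<partial>N) = (\<integral>\<^sup>+y. ?n y \<partial>N) + ennreal \<epsilon> * integral\<^sup>N N \<eta>"
      unfolding w_def by (subst nn_integral_add) (auto simp: nn_integral_cmult)
    then have w_le: "(\<integral>\<^sup>+y. w y \<partial>N) \<le> ennreal a" using \<epsilon> by simp
    then have p_le: "(\<integral>\<^sup>+y. p y \<partial>N) \<le> 1"
      using a unfolding p_def by (subst nn_integral_divide) (auto intro!: divide_le_posI_ennreal)
    have "(\<integral>\<^sup>+y. w y \<partial>N) \<noteq> \<infinity>" using w_le by (auto simp: top_unique)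
    then have w_fin: "AE y in N. w y \<noteq> \<infinity>" by (intro nn_integral_noteq_infinite) auto
    have w_pos: "w y \<noteq> 0" if "y \<in> space N" for y
      using \<eta>_pos[OF that] \<epsilon> by (auto simp: w_def)
    have n_less: "?n y < w y" if "y \<in> space N" "w y \<noteq> \<infinity>" for y
      using \<eta>_pos[OF that(1)] \<epsilon> that(2) unfolding w_def
      by (cases "?n y"; cases "\<eta> y") (auto simp: ennreal_less_iff simp flip: ennreal_mult ennreal_plus)
    \<comment> \<open>The factor \<open>w y\<close> cancels, so the \<open>p\<close>-mean of
      \<open>h y x / w y\<close> is the integral of \<open>h y x\<close> over \<open>a\<close>.
      Jensen is applied at the smaller point with \<open>b\<close> in place of
      \<open>a\<close>.\<close>
    have le: "\<Phi> ((\<integral>\<^sup>+y. h y x \<partial>N) / ennreal b) \<le> (\<integral>\<^sup>+y. p y * \<Phi> (h y x / w y) \<partial>N)"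
      if x[measurable]: "x \<in> space M" for x
    proof (cases "(\<integral>\<^sup>+y. h y x \<partial>N) = 0")
      case True
      then show ?thesis using \<Phi> by (simp add: young_function_def)
    next
      case False
      let ?H = "\<integral>\<^sup>+y. h y x \<partial>N"
      have "(\<integral>\<^sup>+y. p y * (h y x / w y) \<partial>N) = (\<integral>\<^sup>+y. h y x / ennreal a \<partial>N)"
      proof (rule nn_integral_cong_AE)
        show "AE y in N. p y * (h y x / w y) = h y x / ennreal a"
          using w_fin AE_space
        proof eventually_elim
          case (elim y)
          have w_lt: "w y < top" using elim by (simp add: less_top)
          have "p y * (h y x / w y) = h y x * w y / (ennreal a * w y)"
            unfolding p_def divide_ennreal_def ennreal_inverse_mult[OF ennreal_less_top w_lt]
            by (simp only: mult_ac)
          also have "\<dots> = h y x / ennreal a"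
            using elim w_pos by (intro divide_mult_eq) auto
          finally show ?case .
        qed
      qed
      then have *: "(\<integral>\<^sup>+y. p y * (h y x / w y) \<partial>N) = ?H / ennreal a"
        by (simp add: nn_integral_divide)
      show ?thesis
      proof (cases "?H = \<infinity>")
        case True
        \<comment> \<open>The mean is infinite, so Jensen applies at every finite \<open>t\<close>;
          letting \<open>t\<close> grow makes the right side infinite.\<close>
        have "\<Phi> (ennreal t) \<le> (\<integral>\<^sup>+y. p y * \<Phi> (h y x / w y) \<partial>N)" for t
          using True by (intro young_function_jensen[OF \<Phi> _ _ p_le]) (auto simp: * ennreal_top_divide)
        moreover have "((\<lambda>t. \<Phi> (ennreal t)) \<longlongrightarrow> \<infinity>) at_top"
          using \<Phi> by (simp add: young_function_def)
        ultimately have "\<infinity> \<le> (\<integral>\<^sup>+y. p y * \<Phi> (h y x / w y) \<partial>N)"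
          by (intro tendsto_upperbound[where F=at_top]) auto
        then show ?thesis by (simp add: top_unique)
      next
        case False2: False
        have "?H / ennreal b < ?H / ennreal a"
          using False False2 a
          by (cases ?H) (auto simp: divide_ennreal ennreal_less_iff divide_strict_left_mono)
        then show ?thesis
          using young_function_jensen[OF \<Phi> _ _ p_le, of "\<lambda>y. h y x / w y" "?H / ennreal b"] *
          by simp
      qed
    qed
    have "(\<integral>\<^sup>+x. \<Phi> ((\<integral>\<^sup>+y. h y x \<partial>N) / ennreal b) \<partial>M)
        \<le> (\<integral>\<^sup>+x. \<integral>\<^sup>+y. p y * \<Phi> (h y x / w y) \<partial>N \<partial>M)"
      by (rule nn_integral_mono) (rule le)
    \<comment> \<open>After the exchange the inner integral tests the scale \<open>w y\<close> for
      \<open>h y\<close>, hence is at most 1 for almost every \<open>y\<close>; what remains is the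
      mass of \<open>p\<close>.\<close>
    also have "\<dots> = (\<integral>\<^sup>+y. \<integral>\<^sup>+x. p y * \<Phi> (h y x / w y) \<partial>M \<partial>N)"
      by (rule Fubini') measurable
    also have "\<dots> = (\<integral>\<^sup>+y. p y * (\<integral>\<^sup>+x. \<Phi> (h y x / w y) \<partial>M) \<partial>N)"
      by (intro nn_integral_cong nn_integral_cmult) measurable
    also have "\<dots> \<le> (\<integral>\<^sup>+y. p y * 1 \<partial>N)"
    proof (rule nn_integral_mono_AE)
      show "AE y in N. p y * (\<integral>\<^sup>+x. \<Phi> (h y x / w y) \<partial>M) \<le> p y * 1"
        using w_fin AE_space
      proof eventually_elim
        case (elim y)
        then show ?case
          by (intro mult_left_mono nn_integral_le_1_of_luxemburg_norm_less[OF \<Phi> n_less]) auto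
      qed
    qed
    also have "\<dots> \<le> 1" using p_le by simp
    finally show ?thesis unfolding real using a by (intro luxemburg_norm_le) auto
  qed simp
qed

section \<open>The lattice, the torus and translation invariance\<close>

lemma countable_UNIV_vec: "countable (UNIV :: ('a::countable ^ 'n::finite) set)"
proof -
  have "inj (vec_nth :: 'a ^ 'n \<Rightarrow> 'n \<Rightarrow> 'a)" by (simp add: inj_on_def vec_nth_inject)
  then show ?thesis by (rule countableI_type[THEN countable_image_inj_on, rotated])
qed

lemma sigma_finite_count_int_vec: "sigma_finite_measure (count_space (UNIV :: (int ^ 'n::finite) set))"
  by (rule sigma_finite_measure_count_space_countable[OF countable_UNIV_vec])

lemma borel_measurable_vec_nth[measurable]:
  "(\<lambda>x :: real ^ 'n::finite. x $ i) \<in> borel_measurable borel"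
  by (intro borel_measurable_continuous_onI continuous_intros)

lemma borel_measurable_vec_lambda:
  fixes f :: "'a \<Rightarrow> 'n::finite \<Rightarrow> real"
  assumes "\<And>i. (\<lambda>x. f x i) \<in> borel_measurable M"
  shows "(\<lambda>x. \<chi> i. f x i) \<in> borel_measurable M"
  by (subst borel_measurable_euclidean_space) (auto simp: Basis_vec_def inner_axis assms)

definition unit_cube :: "(real ^ 'n) set" where
  "unit_cube = {x. \<forall>i. 0 \<le> x $ i \<and> x $ i < 1}"

lemma unit_cube_borel[measurable]: "unit_cube \<in> sets (borel :: (real ^ 'n::finite) measure)"
  unfolding unit_cube_def by measurable

lemma torus_eq: "torus = restrict_space lborel unit_cube"
  by (simp add: torus_def unit_cube_def)

lemma space_torus: "space (torus :: (real ^ 'n::finite) measure) = unit_cube"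
  by (simp add: torus_eq)

lemma sigma_finite_torus: "sigma_finite_measure (torus :: (real ^ 'n::finite) measure)"
  unfolding torus_eq
  by (rule sigma_finite_measure_restrict_space) (auto intro: lborel.sigma_finite_measure_axioms)

lemma measurable_torusI:
  "f \<in> borel_measurable M \<Longrightarrow> (\<And>x. x \<in> space M \<Longrightarrow> f x \<in> unit_cube) \<Longrightarrow>
    f \<in> M \<rightarrow>\<^sub>M (torus :: (real ^ 'n::finite) measure)"
  unfolding torus_eq by (intro measurable_restrict_space2) auto

lemma torus_nth_measurable[measurable]:
  "(\<lambda>x :: real ^ 'n::finite. x $ i) \<in> borel_measurable torus"
  unfolding torus_eq by (intro measurable_restrict_space1) simp

text \<open>In the fundamental-domain model this is the quotient map from \<open>\<real>^n\<close>
  to the torus.\<close>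

definition frac_vec :: "real ^ 'n \<Rightarrow> real ^ 'n" where
  "frac_vec x = (\<chi> i. frac (x $ i))"

lemma torus_diff_eq: "torus_diff w x = frac_vec (w - x)"
  by (simp add: torus_diff_def frac_vec_def)

lemma frac_vec_in: "frac_vec x \<in> unit_cube"
  by (simp add: frac_vec_def unit_cube_def frac_lt_1)

lemma frac_vec_unit_cube: "x \<in> unit_cube \<Longrightarrow> frac_vec x = x"
  by (simp add: frac_vec_def unit_cube_def frac_eq vec_eq_iff)

lemma borel_measurable_frac[measurable]: "(frac :: real \<Rightarrow> real) \<in> borel_measurable borel"
  unfolding frac_def[abs_def] by measurable

lemma measurable_frac_vec[measurable]:
  "frac_vec \<in> borel \<rightarrow>\<^sub>M (torus :: (real ^ 'n::finite) measure)"
  by (intro measurable_torusI frac_vec_in)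
    (auto simp: frac_vec_def[abs_def] intro!: borel_measurable_vec_lambda)

definition int_vec :: "int ^ 'n \<Rightarrow> real ^ 'n" where
  "int_vec k = (\<chi> i. of_int (k $ i))"

lemma frac_vec_add_int: "frac_vec (x + int_vec k) = frac_vec x"
  by (simp add: frac_vec_def int_vec_def vec_eq_iff frac_def)

lemma nn_integral_lborel_shift:
  fixes f :: "'a::euclidean_space \<Rightarrow> ennreal"
  assumes [measurable]: "f \<in> borel_measurable borel"
  shows "(\<integral>\<^sup>+x. f (c + x) \<partial>lborel) = (\<integral>\<^sup>+x. f x \<partial>lborel)"
  by (subst (2) lborel_distr_plus[of c, symmetric]) (simp add: nn_integral_distr)

text \<open>The cube is half open, so exactly one integer translate of \<open>u\<close> lies in it,
  the one by the negated coordinatewise floors. The translated cubes thus give a partition of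
  unity.\<close>

lemma nn_integral_unit_cube_translates:
  "(\<integral>\<^sup>+k. indicator unit_cube (u + int_vec k) \<partial>count_space UNIV) = (1 :: ennreal)"
  for u :: "real ^ 'n::finite"
proof -
  have "u + int_vec k \<in> unit_cube \<longleftrightarrow> k = (\<chi> i. - \<lfloor>u $ i\<rfloor>)" for k
  proof -
    have "(0 \<le> u $ i + of_int (k $ i) \<and> u $ i + of_int (k $ i) < 1) \<longleftrightarrow> k $ i = - \<lfloor>u $ i\<rfloor>" for i
      by linarith
    then show ?thesis by (simp add: unit_cube_def int_vec_def vec_eq_iff)
  qed
  then have "indicator unit_cube (u + int_vec k) = (indicator {\<chi> i. - \<lfloor>u $ i\<rfloor>} k :: ennreal)" for k
    by (auto simp: indicator_def)
  then show ?thesis by simp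
qed

lemma nn_integral_unit_cube_translates':
  "(\<integral>\<^sup>+k. indicator unit_cube (u - int_vec k) \<partial>count_space UNIV) = (1 :: ennreal)"
  for u :: "real ^ 'n::finite"
proof -
  have "(\<integral>\<^sup>+k. indicator unit_cube (u + int_vec (- k)) \<partial>count_space UNIV)
      = (\<integral>\<^sup>+k. indicator unit_cube (u + int_vec k) \<partial>count_space UNIV)"
    by (rule nn_integral_bij_count_space[OF bij_uminus])
  moreover have "u + int_vec (- k) = u - int_vec k" for k
    by (simp add: int_vec_def vec_eq_iff)
  ultimately show ?thesis by (simp add: nn_integral_unit_cube_translates)
qed

text \<open>Both sides are integrals of a \<open>\<int>\<^sup>n\<close>-periodic function over a fundamental domain: insert the
  partition of unity by integer translates of the cube and shift each piece.\<close>

lemma nn_integral_torus_shift: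
  fixes f :: "real ^ 'n::finite \<Rightarrow> ennreal"
  assumes [measurable]: "f \<in> borel_measurable torus"
  shows "(\<integral>\<^sup>+w. f (torus_diff w x) \<partial>torus) = (\<integral>\<^sup>+w. f w \<partial>torus)"
proof -
  interpret C: sigma_finite_measure "count_space (UNIV :: (int ^ 'n) set)"
    by (rule sigma_finite_count_int_vec)
  interpret pair_sigma_finite lborel "count_space (UNIV :: (int ^ 'n) set)" ..
  \<comment> \<open>The periodic extension of \<open>f\<close> to the whole space, where Lebesgue
    measure can be shifted freely.\<close>
  define P where "P w = f (frac_vec w)" for w
  have [measurable]: "P \<in> borel_measurable borel" unfolding P_def[abs_def] by measurable
  have P_per: "P (w + int_vec k) = P w" for w k by (simp add: P_def frac_vec_add_int)
  have [measurable]: "int_vec \<in> count_space UNIV \<rightarrow>\<^sub>M borel" by simp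
  let ?Q = "indicator unit_cube :: real ^ 'n \<Rightarrow> ennreal"
  have "(\<integral>\<^sup>+w. f (torus_diff w x) \<partial>torus) = (\<integral>\<^sup>+w. P (w - x) * ?Q w \<partial>lborel)"
    unfolding torus_eq torus_diff_eq P_def by (rule nn_integral_restrict_space) simp
  \<comment> \<open>The translation by \<open>x\<close> passes from the function to the
    cube.\<close>
  also have "\<dots> = (\<integral>\<^sup>+w. P (x + w - x) * ?Q (x + w) \<partial>lborel)"
    by (rule nn_integral_lborel_shift[symmetric]) measurable
  also have "\<dots> = (\<integral>\<^sup>+w. \<integral>\<^sup>+k. P w * ?Q (x + w) * ?Q (w - int_vec k) \<partial>count_space UNIV \<partial>lborel)"
    by (simp add: nn_integral_cmult nn_integral_unit_cube_translates')
  also have "\<dots> = (\<integral>\<^sup>+k. \<integral>\<^sup>+w. P w * ?Q (x + w) * ?Q (w - int_vec k) \<partial>lborel \<partial>count_space UNIV)"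
    by (rule Fubini'[symmetric]) measurable
  \<comment> \<open>Shift the piece with index \<open>k\<close> by \<open>k\<close>:
    \<open>P\<close> absorbs it by periodicity, the inserted cube becomes the standard one, and the
    cube moved by \<open>x\<close> now carries \<open>k\<close>, so that summing over
    \<open>k\<close> removes it.\<close>
  also have "\<dots> = (\<integral>\<^sup>+k. \<integral>\<^sup>+w. P (int_vec k + w) * ?Q (x + (int_vec k + w)) *
      ?Q (int_vec k + w - int_vec k) \<partial>lborel \<partial>count_space UNIV)"
    by (intro nn_integral_cong nn_integral_lborel_shift[symmetric]) measurable
  also have "\<dots> = (\<integral>\<^sup>+k. \<integral>\<^sup>+w. P w * ?Q w * ?Q (x + w + int_vec k) \<partial>lborel \<partial>count_space UNIV)"
    using P_per by (simp add: add_ac mult_ac)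
  also have "\<dots> = (\<integral>\<^sup>+w. \<integral>\<^sup>+k. P w * ?Q w * ?Q (x + w + int_vec k) \<partial>count_space UNIV \<partial>lborel)"
    by (rule Fubini') measurable
  also have "\<dots> = (\<integral>\<^sup>+w. P w * ?Q w \<partial>lborel)"
    by (simp add: nn_integral_cmult nn_integral_unit_cube_translates)
  also have "\<dots> = (\<integral>\<^sup>+w. f w * ?Q w \<partial>lborel)"
    by (intro nn_integral_cong) (auto simp: P_def frac_vec_unit_cube split: split_indicator)
  also have "\<dots> = (\<integral>\<^sup>+w. f w \<partial>torus)"
    unfolding torus_eq by (rule nn_integral_restrict_space[symmetric]) simp
  finally show ?thesis .
qed

lemma nn_integral_count_space_shift:
  fixes f :: "'a::ab_group_add \<Rightarrow> ennreal"
  shows "(\<integral>\<^sup>+m. f (m - l) \<partial>count_space UNIV) = (\<integral>\<^sup>+m. f m \<partial>count_space UNIV)"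
  by (rule nn_integral_bij_count_space) (rule bij_diff_right)

definition ZT_diff ::
  "(int ^ 'n) \<times> (real ^ 'n) \<Rightarrow> (int ^ 'n) \<times> (real ^ 'n) \<Rightarrow> (int ^ 'n) \<times> (real ^ 'n)" where
  "ZT_diff z y = (fst z - fst y, torus_diff (snd z) (snd y))"

lemma sigma_finite_ZT: "sigma_finite_measure (ZT :: ((int ^ 'n::finite) \<times> (real ^ 'n)) measure)"
  unfolding ZT_def
  by (rule sigma_finite_pair_measure[OF sigma_finite_count_int_vec sigma_finite_torus])

lemma measurable_torus_diff[measurable]:
  "(\<lambda>p. torus_diff (fst p) (snd p)) \<in> torus \<Otimes>\<^sub>M torus \<rightarrow>\<^sub>M (torus :: (real ^ 'n::finite) measure)"
  unfolding torus_diff_def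
  by (intro measurable_torusI borel_measurable_vec_lambda)
    (auto simp: unit_cube_def frac_lt_1)

lemma measurable_ZT_diff[measurable]:
  "(\<lambda>p. ZT_diff (fst p) (snd p)) \<in> ZT \<Otimes>\<^sub>M ZT \<rightarrow>\<^sub>M (ZT :: ((int ^ 'n::finite) \<times> (real ^ 'n)) measure)"
proof -
  \<comment> \<open>On countable sets the product of discrete sigma-algebras is discrete, so
    subtraction on the lattice is measurable.\<close>
  have *: "count_space UNIV \<Otimes>\<^sub>M count_space UNIV = count_space (UNIV :: ((int ^ 'n) \<times> (int ^ 'n)) set)"
    using pair_measure_countable[OF countable_UNIV_vec countable_UNIV_vec] by simp
  have [measurable]: "(\<lambda>p. fst p - snd p) \<in> count_space UNIV \<Otimes>\<^sub>M count_space UNIV \<rightarrow>\<^sub>M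
      count_space (UNIV :: (int ^ 'n) set)"
    unfolding * by simp
  have [measurable]: "fst \<in> ZT \<rightarrow>\<^sub>M count_space (UNIV :: (int ^ 'n) set)"
    "snd \<in> ZT \<rightarrow>\<^sub>M (torus :: (real ^ 'n::finite) measure)"
    unfolding ZT_def by measurable
  have "(\<lambda>p. fst (fst p) - fst (snd p)) \<in> ZT \<Otimes>\<^sub>M ZT \<rightarrow>\<^sub>M count_space (UNIV :: (int ^ 'n) set)"
    using measurable_compose[of "\<lambda>p. (fst (fst p), fst (snd p))" "ZT \<Otimes>\<^sub>M ZT"
        "count_space UNIV \<Otimes>\<^sub>M count_space UNIV" "\<lambda>p. fst p - snd p"] by simp
  moreover have "(\<lambda>p. torus_diff (snd (fst p)) (snd (snd p))) \<in> ZT \<Otimes>\<^sub>M ZT \<rightarrow>\<^sub>M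
      (torus :: (real ^ 'n::finite) measure)"
    by (rule measurable_compose[OF _ measurable_torus_diff,
          of "\<lambda>p. (snd (fst p), snd (snd p))", simplified]) measurable
  ultimately show ?thesis
    unfolding ZT_diff_def by (subst (3) ZT_def) (rule measurable_Pair)
qed

lemma nn_integral_ZT_shift:
  fixes f :: "(int ^ 'n::finite) \<times> (real ^ 'n) \<Rightarrow> ennreal"
  assumes [measurable]: "f \<in> borel_measurable ZT" and y: "y \<in> space ZT"
  shows "(\<integral>\<^sup>+z. f (ZT_diff z y) \<partial>ZT) = (\<integral>\<^sup>+z. f z \<partial>ZT)"
proof -
  interpret T: sigma_finite_measure "torus :: (real ^ 'n) measure" by (rule sigma_finite_torus)
  have f[measurable]: "f \<in> borel_measurable (count_space UNIV \<Otimes>\<^sub>M torus)"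
    using assms(1) unfolding ZT_def .
  have fy: "(\<lambda>z. f (ZT_diff z y)) \<in> borel_measurable (count_space UNIV \<Otimes>\<^sub>M torus)"
    using measurable_compose[OF measurable_Pair2'[OF y] measurable_compose[OF measurable_ZT_diff assms(1)]]
    by (simp add: ZT_def)
  have "(\<integral>\<^sup>+z. f (ZT_diff z y) \<partial>ZT)
      = (\<integral>\<^sup>+m. \<integral>\<^sup>+w. f (m - fst y, torus_diff w (snd y)) \<partial>torus \<partial>count_space UNIV)"
    unfolding ZT_def by (subst T.nn_integral_fst[OF fy, symmetric]) (simp add: ZT_diff_def)
  also have "\<dots> = (\<integral>\<^sup>+m. \<integral>\<^sup>+w. f (m - fst y, w) \<partial>torus \<partial>count_space UNIV)"
    by (intro nn_integral_cong nn_integral_torus_shift) measurable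
  also have "\<dots> = (\<integral>\<^sup>+m. \<integral>\<^sup>+w. f (m, w) \<partial>torus \<partial>count_space UNIV)"
    by (rule nn_integral_count_space_shift)
  also have "\<dots> = (\<integral>\<^sup>+z. f z \<partial>ZT)"
    unfolding ZT_def by (subst T.nn_integral_fst) auto
  finally show ?thesis .
qed

section \<open>The convolution: measurability and a pointwise bound\<close>

lemma conv_integrand_eq: "conv_integrand F G z y = F y * G (ZT_diff z y)"
  by (cases z; cases y) (simp add: conv_integrand_def ZT_diff_def)

lemma measurable_conv_integrand:
  assumes [measurable]: "F \<in> borel_measurable ZT" "G \<in> borel_measurable ZT"
  shows "(\<lambda>p. conv_integrand F G (fst p) (snd p)) \<in>
    borel_measurable (ZT \<Otimes>\<^sub>M (ZT :: ((int ^ 'n::finite) \<times> (real ^ 'n)) measure))"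
  unfolding conv_integrand_eq by measurable

text \<open>Integrability is not assumed: otherwise the integral has the default value 0.\<close>

lemma norm_integral_le_nn_integral:
  fixes f :: "'a \<Rightarrow> 'b::{banach, second_countable_topology}"
  shows "ennreal (norm (integral\<^sup>L M f)) \<le> (\<integral>\<^sup>+x. norm (f x) \<partial>M)"
  by (cases "integrable M f") (auto intro: integral_norm_bound_ennreal simp: not_integrable_integral_eq)

text \<open>For complex families summability and absolute summability coincide, so both sides take
  the default value 0 for the same \<open>f\<close>. The sum in \<open>conv\<close> thereby becomes
  an integral over counting measure, open to measurability and norm bounds for integrals.\<close>

lemma infsum_complex_eq_integral:
  fixes f :: "'a \<Rightarrow> complex"
  shows "infsum f A = integral\<^sup>L (count_space A) f"
proof (cases "integrable (count_space A) f")
  case True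
  then show ?thesis
    using infsetsum_infsum[of f A] by (simp add: abs_summable_on_def infsetsum_def)
next
  case False
  then have "\<not> f summable_on A"
    using summable_on_iff_abs_summable_on_complex abs_summable_equivalent abs_summable_on_def by metis
  then show ?thesis using False by (simp add: infsum_not_exists not_integrable_integral_eq)
qed

lemma conv_eq_integral:
  "conv F G z = (LINT l|count_space UNIV. LINT x|torus. conv_integrand F G z (l, x))"
  by (simp add: conv_def infsum_complex_eq_integral)

lemma borel_measurable_conv:
  fixes F G :: "(int ^ 'n::finite) \<times> (real ^ 'n) \<Rightarrow> complex"
  assumes F: "F \<in> borel_measurable ZT" and G: "G \<in> borel_measurable ZT"
  shows "conv F G \<in> borel_measurable ZT"
proof -
  interpret C: sigma_finite_measure "count_space (UNIV :: (int ^ 'n) set)"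
    by (rule sigma_finite_count_int_vec)
  interpret T: sigma_finite_measure "torus :: (real ^ 'n) measure" by (rule sigma_finite_torus)
  have "(\<lambda>q. ((fst (fst q)), (snd (fst q), snd q))) \<in>
     (ZT \<Otimes>\<^sub>M count_space UNIV) \<Otimes>\<^sub>M torus \<rightarrow>\<^sub>M ZT \<Otimes>\<^sub>M (ZT :: ((int ^ 'n) \<times> (real ^ 'n)) measure)"
    by (subst (2) ZT_def) measurable
  from measurable_compose[OF this measurable_conv_integrand[OF F G]]
  have m: "(\<lambda>q. conv_integrand F G (fst (fst q)) (snd (fst q), snd q)) \<in>
      borel_measurable ((ZT \<Otimes>\<^sub>M count_space UNIV) \<Otimes>\<^sub>M torus)"
    by simp
  have [measurable]: "(\<lambda>(z, l). LINT x|torus. conv_integrand F G z (l, x)) \<in>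
      borel_measurable (ZT \<Otimes>\<^sub>M count_space UNIV)"
    using T.borel_measurable_lebesgue_integral[of "\<lambda>p x. conv_integrand F G (fst p) (snd p, x)" "ZT \<Otimes>\<^sub>M count_space UNIV"] m
    by (simp add: case_prod_beta')
  show ?thesis
    unfolding conv_eq_integral[abs_def] by measurable
qed

text \<open>The triangle inequality for the outer and the inner integral. The default value 0 makes
  it valid also where the convolution diverges, so the norm estimates can be made independently of
  existence.\<close>

lemma norm_conv_le:
  fixes F G :: "(int ^ 'n::finite) \<times> (real ^ 'n) \<Rightarrow> complex"
  assumes F: "F \<in> borel_measurable ZT" and G: "G \<in> borel_measurable ZT" and z: "z \<in> space ZT"
  shows "ennreal (cmod (conv F G z)) \<le> (\<integral>\<^sup>+y. ennreal (cmod (conv_integrand F G z y)) \<partial>ZT)"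
proof -
  interpret T: sigma_finite_measure "torus :: (real ^ 'n) measure" by (rule sigma_finite_torus)
  have m[measurable]: "conv_integrand F G z \<in> borel_measurable (count_space UNIV \<Otimes>\<^sub>M torus)"
    using measurable_compose[OF measurable_Pair1'[OF z] measurable_conv_integrand[OF F G]]
    by (simp add: ZT_def)
  have "ennreal (cmod (conv F G z))
      \<le> (\<integral>\<^sup>+l. ennreal (cmod (LINT x|torus. conv_integrand F G z (l, x))) \<partial>count_space UNIV)"
    unfolding conv_eq_integral by (rule norm_integral_le_nn_integral)
  also have "\<dots> \<le> (\<integral>\<^sup>+l. \<integral>\<^sup>+x. ennreal (cmod (conv_integrand F G z (l, x))) \<partial>torus \<partial>count_space UNIV)"
    by (intro nn_integral_mono norm_integral_le_nn_integral)
  also have "\<dots> = (\<integral>\<^sup>+y. ennreal (cmod (conv_integrand F G z y)) \<partial>ZT)"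
    unfolding ZT_def by (subst T.nn_integral_fst[symmetric]) auto
  finally show ?thesis .
qed

section \<open>Norm estimates and existence of the convolution\<close>

context
  fixes F G :: "(int ^ 'n::finite) \<times> (real ^ 'n) \<Rightarrow> complex"
  assumes F[measurable]: "F \<in> borel_measurable ZT" and G[measurable]: "G \<in> borel_measurable ZT"
begin

text \<open>The integration variable \<open>y\<close> comes first, so that
  \<open>integrand_norm y\<close> is the family of functions to which Minkowski applies.\<close>

private abbreviation "integrand_norm y z \<equiv> ennreal (cmod (conv_integrand F G z y))"

private abbreviation "abs_conv z \<equiv> \<integral>\<^sup>+y. integrand_norm y z \<partial>ZT"

private lemma integrand_norm_eq:
  "integrand_norm y z = ennreal (cmod (F y)) * ennreal (cmod (G (ZT_diff z y)))"
  by (simp add: conv_integrand_eq norm_mult ennreal_mult)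

private lemma measurable_integrand_norm[measurable]:
  "(\<lambda>p. integrand_norm (fst p) (snd p)) \<in> borel_measurable (ZT \<Otimes>\<^sub>M ZT)"
  using measurable_compose[OF measurable_pair_swap' measurable_conv_integrand[OF F G]]
  by (simp add: case_prod_beta')

private lemma measurable_abs_conv[measurable]: "abs_conv \<in> borel_measurable ZT"
proof -
  interpret sigma_finite_measure "ZT :: ((int ^ 'n) \<times> (real ^ 'n)) measure" by (rule sigma_finite_ZT)
  note [measurable] = measurable_conv_integrand[OF F G]
  show ?thesis by measurable
qed

private lemma conv_exists_if_AE_finite:
  assumes "AE z in ZT. abs_conv z < \<infinity>"
  shows "conv_exists F G"
  unfolding conv_exists_def using assms AE_space
proof eventually_elim
  case (elim z)
  have "conv_integrand F G z \<in> borel_measurable ZT"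
    using measurable_compose[OF measurable_Pair1'[OF elim(2)] measurable_conv_integrand[OF F G]] by simp
  then show ?case using elim by (simp add: integrable_iff_bounded)
qed

text \<open>Minkowski moves the norm inside the integral over \<open>y\<close>, where each function
  is the constant \<open>cmod (F y)\<close> times a translate of \<open>cmod\<close> of
  \<open>G\<close>.\<close>

private lemma orlicz_norm_abs_conv_le:
  assumes \<Phi>: "young_function \<Phi>"
  shows "luxemburg_norm \<Phi> ZT abs_conv \<le> L1_norm ZT F * orlicz_norm \<Phi> ZT G"
proof -
  note [measurable] = young_function_measurable[OF \<Phi>]
  have "luxemburg_norm \<Phi> ZT abs_conv \<le> (\<integral>\<^sup>+y. luxemburg_norm \<Phi> ZT (integrand_norm y) \<partial>ZT)"
    by (rule luxemburg_norm_nn_integral_le[OF \<Phi> sigma_finite_ZT sigma_finite_ZT])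
      (unfold case_prod_beta', rule measurable_integrand_norm)
  also have "\<dots> \<le> (\<integral>\<^sup>+y. ennreal (cmod (F y)) * orlicz_norm \<Phi> ZT G \<partial>ZT)"
  proof (rule nn_integral_mono)
    fix y :: "(int ^ 'n) \<times> (real ^ 'n)" assume y: "y \<in> space ZT"
    \<comment> \<open>Invariance of the integral at each scale \<open>b\<close> shows that both
      functions have the same admissible scales.\<close>
    have "luxemburg_norm \<Phi> ZT (\<lambda>z. ennreal (cmod (G (ZT_diff z y)))) = orlicz_norm \<Phi> ZT G"
      unfolding orlicz_norm_def luxemburg_norm_def
      using nn_integral_ZT_shift[OF _ y, of "\<lambda>z. \<Phi> (ennreal (cmod (G z)) / ennreal b)" for b]
      by simp
    then show "luxemburg_norm \<Phi> ZT (integrand_norm y) \<le> ennreal (cmod (F y)) * orlicz_norm \<Phi> ZT G"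
      unfolding integrand_norm_eq by (metis luxemburg_norm_cmult_le[OF \<Phi> norm_ge_zero])
  qed
  also have "\<dots> = L1_norm ZT F * orlicz_norm \<Phi> ZT G"
    by (simp add: L1_norm_def nn_integral_multc)
  finally show ?thesis .
qed

lemma orlicz_conv:
  assumes \<Phi>: "young_function \<Phi>"
    and fin: "L1_norm ZT F < \<infinity>" "orlicz_norm \<Phi> ZT G < \<infinity>"
  shows "conv_exists F G"
    and "orlicz_norm \<Phi> ZT (conv F G) \<le> L1_norm ZT F * orlicz_norm \<Phi> ZT G"
proof -
  have "luxemburg_norm \<Phi> ZT abs_conv < \<infinity>"
    by (rule le_less_trans[OF orlicz_norm_abs_conv_le[OF \<Phi>]])
      (use fin in \<open>simp add: ennreal_mult_less_top\<close>)
  then show "conv_exists F G"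
    by (intro conv_exists_if_AE_finite AE_finite_of_luxemburg_norm_finite[OF \<Phi>]) auto
  have "orlicz_norm \<Phi> ZT (conv F G) \<le> luxemburg_norm \<Phi> ZT abs_conv"
    unfolding orlicz_norm_def by (intro luxemburg_norm_mono[OF \<Phi>] norm_conv_le[OF F G])
  also note orlicz_norm_abs_conv_le[OF \<Phi>]
  finally show "orlicz_norm \<Phi> ZT (conv F G) \<le> L1_norm ZT F * orlicz_norm \<Phi> ZT G" .
qed

private lemma measurable_fiber:
  assumes [measurable]: "f \<in> borel_measurable ZT"
  shows "(\<lambda>(w, m). f (m, w)) \<in> borel_measurable (torus \<Otimes>\<^sub>M count_space (UNIV :: (int ^ 'n) set))"
  using measurable_compose[OF measurable_pair_swap' assms[unfolded ZT_def]]
  by (simp add: case_prod_beta')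

text \<open>The inner Minkowski inequality leaves the fibre norm \<open>g\<close> of
  \<open>G\<close>, shifted on the torus only; the outer one then treats \<open>g\<close> as the
  second part treats \<open>G\<close>.\<close>

private lemma mixed_norm_abs_conv_le:
  assumes \<Phi>1: "young_function \<Phi>1" and \<Phi>2: "young_function \<Phi>2"
  shows "luxemburg_norm \<Phi>2 torus (\<lambda>w. luxemburg_norm \<Phi>1 (count_space UNIV) (\<lambda>m. abs_conv (m, w)))
    \<le> L1_norm ZT F * mixed_orlicz_norm \<Phi>1 \<Phi>2 G"
proof -
  note C = sigma_finite_count_int_vec[where 'n='n]
  note [measurable] = young_function_measurable[OF \<Phi>1] young_function_measurable[OF \<Phi>2]
  define g where "g w = orlicz_norm \<Phi>1 (count_space UNIV) (\<lambda>m. G (m, w))" for w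
  have g_meas[measurable]: "g \<in> borel_measurable torus"
    unfolding g_def[abs_def] orlicz_norm_def
    by (rule borel_measurable_luxemburg_norm[OF \<Phi>1 C measurable_fiber]) measurable
  have snd_meas[measurable]: "snd \<in> ZT \<rightarrow>\<^sub>M (torus :: (real ^ 'n) measure)"
    unfolding ZT_def by measurable
  have *: "luxemburg_norm \<Phi>1 (count_space UNIV) (\<lambda>m. abs_conv (m, w))
      \<le> (\<integral>\<^sup>+y. ennreal (cmod (F y)) * g (torus_diff w (snd y)) \<partial>ZT)" if w: "w \<in> space torus" for w
  proof -
    have "(\<lambda>(y, m). (y, (m, w))) \<in> ZT \<Otimes>\<^sub>M count_space UNIV \<rightarrow>\<^sub>M
        ZT \<Otimes>\<^sub>M (ZT :: ((int ^ 'n) \<times> (real ^ 'n)) measure)"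
      using w by (subst (3) ZT_def) measurable
    from measurable_compose[OF this measurable_integrand_norm]
    have "(\<lambda>(y, m). integrand_norm y (m, w)) \<in> borel_measurable (ZT \<Otimes>\<^sub>M count_space UNIV)"
      by (simp add: case_prod_beta')
    then have "luxemburg_norm \<Phi>1 (count_space UNIV) (\<lambda>m. abs_conv (m, w))
        \<le> (\<integral>\<^sup>+y. luxemburg_norm \<Phi>1 (count_space UNIV) (\<lambda>m. integrand_norm y (m, w)) \<partial>ZT)"
      by (rule luxemburg_norm_nn_integral_le[OF \<Phi>1 C sigma_finite_ZT])
    also have "\<dots> \<le> (\<integral>\<^sup>+y. ennreal (cmod (F y)) * g (torus_diff w (snd y)) \<partial>ZT)"
    proof (rule nn_integral_mono)
      fix y :: "(int ^ 'n) \<times> (real ^ 'n)"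
      \<comment> \<open>Subtracting \<open>fst y\<close> permutes the lattice, so the fibre norm
        only sees the torus part of the translation.\<close>
      have "luxemburg_norm \<Phi>1 (count_space UNIV) (\<lambda>m. ennreal (cmod (G (ZT_diff (m, w) y))))
          = g (torus_diff w (snd y))"
        unfolding g_def orlicz_norm_def luxemburg_norm_def ZT_diff_def fst_conv snd_conv
        using nn_integral_count_space_shift[of
            "\<lambda>m. \<Phi>1 (ennreal (cmod (G (m, torus_diff w (snd y)))) / ennreal b)" "fst y" for b]
        by simp
      then show "luxemburg_norm \<Phi>1 (count_space UNIV) (\<lambda>m. integrand_norm y (m, w))
          \<le> ennreal (cmod (F y)) * g (torus_diff w (snd y))"
        unfolding integrand_norm_eq by (metis luxemburg_norm_cmult_le[OF \<Phi>1 norm_ge_zero])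
    qed
    finally show ?thesis .
  qed
  have "(\<lambda>p. torus_diff (snd p) (snd (fst p))) \<in> ZT \<Otimes>\<^sub>M torus \<rightarrow>\<^sub>M (torus :: (real ^ 'n) measure)"
    by (rule measurable_compose[OF _ measurable_torus_diff,
          of "\<lambda>p. (snd p, snd (fst p))", simplified]) measurable
  from measurable_compose[OF this g_meas]
  have [measurable]: "(\<lambda>p. g (torus_diff (snd p) (snd (fst p)))) \<in> borel_measurable (ZT \<Otimes>\<^sub>M torus)"
    by simp
  have "luxemburg_norm \<Phi>2 torus (\<lambda>w. luxemburg_norm \<Phi>1 (count_space UNIV) (\<lambda>m. abs_conv (m, w)))
      \<le> luxemburg_norm \<Phi>2 torus (\<lambda>w. \<integral>\<^sup>+y. ennreal (cmod (F y)) * g (torus_diff w (snd y)) \<partial>ZT)"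
    by (intro luxemburg_norm_mono[OF \<Phi>2] *)
  also have "\<dots> \<le> (\<integral>\<^sup>+y. luxemburg_norm \<Phi>2 torus
      (\<lambda>w. ennreal (cmod (F y)) * g (torus_diff w (snd y))) \<partial>ZT)"
    by (rule luxemburg_norm_nn_integral_le[OF \<Phi>2 sigma_finite_torus sigma_finite_ZT])
      (simp add: case_prod_beta')
  also have "\<dots> \<le> (\<integral>\<^sup>+y. ennreal (cmod (F y)) * mixed_orlicz_norm \<Phi>1 \<Phi>2 G \<partial>ZT)"
  proof (rule nn_integral_mono)
    fix y :: "(int ^ 'n) \<times> (real ^ 'n)"
    have "luxemburg_norm \<Phi>2 torus (\<lambda>w. g (torus_diff w (snd y))) = mixed_orlicz_norm \<Phi>1 \<Phi>2 G"
      unfolding mixed_orlicz_norm_def g_def[symmetric] luxemburg_norm_def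
      using nn_integral_torus_shift[of "\<lambda>w. \<Phi>2 (g w / ennreal b)" "snd y" for b]
      by simp
    then show "luxemburg_norm \<Phi>2 torus (\<lambda>w. ennreal (cmod (F y)) * g (torus_diff w (snd y)))
        \<le> ennreal (cmod (F y)) * mixed_orlicz_norm \<Phi>1 \<Phi>2 G"
      by (metis luxemburg_norm_cmult_le[OF \<Phi>2 norm_ge_zero])
  qed
  also have "\<dots> = L1_norm ZT F * mixed_orlicz_norm \<Phi>1 \<Phi>2 G"
    by (simp add: L1_norm_def nn_integral_multc)
  finally show ?thesis .
qed

lemma mixed_orlicz_conv:
  assumes \<Phi>1: "young_function \<Phi>1" and \<Phi>2: "young_function \<Phi>2"
    and fin: "L1_norm ZT F < \<infinity>" "mixed_orlicz_norm \<Phi>1 \<Phi>2 G < \<infinity>"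
  shows "conv_exists F G"
    and "mixed_orlicz_norm \<Phi>1 \<Phi>2 (conv F G) \<le> L1_norm ZT F * mixed_orlicz_norm \<Phi>1 \<Phi>2 G"
proof -
  note C = sigma_finite_count_int_vec[where 'n='n]
  interpret C: sigma_finite_measure "count_space (UNIV :: (int ^ 'n) set)" by (rule C)
  interpret T: sigma_finite_measure "torus :: (real ^ 'n) measure" by (rule sigma_finite_torus)
  interpret pair_sigma_finite "count_space (UNIV :: (int ^ 'n) set)" "torus :: (real ^ 'n) measure" ..
  let ?g = "\<lambda>w. luxemburg_norm \<Phi>1 (count_space UNIV) (\<lambda>m. abs_conv (m, w))"
  have [measurable]: "?g \<in> borel_measurable torus"
    by (rule borel_measurable_luxemburg_norm[OF \<Phi>1 C measurable_fiber]) measurable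
  have "luxemburg_norm \<Phi>2 torus ?g < \<infinity>"
    by (rule le_less_trans[OF mixed_norm_abs_conv_le[OF \<Phi>1 \<Phi>2]])
      (use fin in \<open>simp add: ennreal_mult_less_top\<close>)
  then have "AE w in torus. ?g w < \<infinity>"
    by (intro AE_finite_of_luxemburg_norm_finite[OF \<Phi>2]) auto
  then have "AE w in torus. AE m in count_space UNIV. abs_conv (m, w) < \<infinity>"
    by eventually_elim (rule AE_finite_of_luxemburg_norm_finite[OF \<Phi>1], auto)
  moreover have [measurable]: "abs_conv \<in> borel_measurable (count_space UNIV \<Otimes>\<^sub>M torus)"
    using measurable_abs_conv unfolding ZT_def .
  \<comment> \<open>Finiteness is known with \<open>w\<close> outermost, while the product measure
    has \<open>m\<close> as its first coordinate; measurability of \<open>abs_conv\<close> permits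
    the exchange of the two quantifiers.\<close>
  ultimately have "AE m in count_space UNIV. AE w in torus. abs_conv (m, w) < \<infinity>"
    by (subst AE_commute) auto
  then have "AE z in count_space UNIV \<Otimes>\<^sub>M torus. abs_conv z < \<infinity>"
    by (intro AE_pair_measure) auto
  then have "AE z in ZT. abs_conv z < \<infinity>" unfolding ZT_def .
  then show "conv_exists F G" by (rule conv_exists_if_AE_finite)
  have "mixed_orlicz_norm \<Phi>1 \<Phi>2 (conv F G) \<le> luxemburg_norm \<Phi>2 torus ?g"
    unfolding mixed_orlicz_norm_def orlicz_norm_def
    by (intro luxemburg_norm_mono[OF \<Phi>2] luxemburg_norm_mono[OF \<Phi>1] norm_conv_le[OF F G])
      (simp add: ZT_def space_pair_measure)
  also note mixed_norm_abs_conv_le[OF \<Phi>1 \<Phi>2]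
  finally show "mixed_orlicz_norm \<Phi>1 \<Phi>2 (conv F G) \<le> L1_norm ZT F * mixed_orlicz_norm \<Phi>1 \<Phi>2 G" .
qed

end

theorem proposition3p4:
  fixes F G :: "(int ^ 'n) \<times> (real ^ 'n) \<Rightarrow> complex"
    and \<Phi> \<Phi>1 \<Phi>2 :: "ennreal \<Rightarrow> ennreal"
  shows
    "(young_function \<Phi>1 \<and> strictly_convex \<Phi>1 \<and> local_Delta2 \<Phi>1 \<and>
      young_function \<Phi>2 \<and> strictly_convex \<Phi>2 \<and> local_Delta2 \<Phi>2 \<and>
      F \<in> L1_space ZT \<and> G \<in> mixed_orlicz_space \<Phi>1 \<Phi>2 \<longrightarrow>
        conv_exists F G \<and> conv F G \<in> mixed_orlicz_space \<Phi>1 \<Phi>2 \<and>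
        mixed_orlicz_norm \<Phi>1 \<Phi>2 (conv F G) \<le> L1_norm ZT F * mixed_orlicz_norm \<Phi>1 \<Phi>2 G)
     \<and>
     (young_function \<Phi> \<and> local_Delta2 \<Phi> \<and>
      F \<in> L1_space ZT \<and> G \<in> orlicz_space \<Phi> ZT \<longrightarrow>
        conv_exists F G \<and> conv F G \<in> orlicz_space \<Phi> ZT \<and>
        orlicz_norm \<Phi> ZT (conv F G) \<le> L1_norm ZT F * orlicz_norm \<Phi> ZT G)"
proof (intro conjI[of "_ \<longrightarrow> _"] impI; elim conjE)
  assume \<Phi>: "young_function \<Phi>1" "young_function \<Phi>2"
    and F: "F \<in> L1_space ZT" and G: "G \<in> mixed_orlicz_space \<Phi>1 \<Phi>2"
  have m: "F \<in> borel_measurable ZT" "G \<in> borel_measurable ZT"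
    and fin: "L1_norm ZT F < \<infinity>" "mixed_orlicz_norm \<Phi>1 \<Phi>2 G < \<infinity>"
    using F G by (auto simp: L1_space_def mixed_orlicz_space_def)
  \<comment> \<open>A finite bound, together with measurability of \<open>conv F G\<close>, gives
    membership in the space.\<close>
  have "L1_norm ZT F * mixed_orlicz_norm \<Phi>1 \<Phi>2 G < \<infinity>"
    using fin by (simp add: ennreal_mult_less_top)
  with mixed_orlicz_conv[OF m \<Phi> fin] borel_measurable_conv[OF m]
  show "conv_exists F G \<and> conv F G \<in> mixed_orlicz_space \<Phi>1 \<Phi>2 \<and>
      mixed_orlicz_norm \<Phi>1 \<Phi>2 (conv F G) \<le> L1_norm ZT F * mixed_orlicz_norm \<Phi>1 \<Phi>2 G"
    by (auto simp: mixed_orlicz_space_def intro: le_less_trans)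
next
  assume \<Phi>: "young_function \<Phi>" and F: "F \<in> L1_space ZT" and G: "G \<in> orlicz_space \<Phi> ZT"
  have m: "F \<in> borel_measurable ZT" "G \<in> borel_measurable ZT"
    and fin: "L1_norm ZT F < \<infinity>" "orlicz_norm \<Phi> ZT G < \<infinity>"
    using F G by (auto simp: L1_space_def orlicz_space_def)
  have "L1_norm ZT F * orlicz_norm \<Phi> ZT G < \<infinity>"
    using fin by (simp add: ennreal_mult_less_top)
  with orlicz_conv[OF m \<Phi> fin] borel_measurable_conv[OF m]
  show "conv_exists F G \<and> conv F G \<in> orlicz_space \<Phi> ZT \<and>
      orlicz_norm \<Phi> ZT (conv F G) \<le> L1_norm ZT F * orlicz_norm \<Phi> ZT G"
    by (auto simp: orlicz_space_def intro: le_less_trans)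
qed

end
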